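(* Let $\mathcal{P}$ be a finite set of points in $\mathbb{R}^d$ and $\textsf{minPts}\geq 1$ an integer. Let $T$ be a rooted binary tree whose leaves are the singletons $\{p\}$, $p\in\mathcal{P}$, where each internal node is the union of the point sets of its two children and the root is $\mathcal{P}$. Let $S$ be the set of pairs of nodes of $T$ produced by the following procedure: for every internal node $N$ of $T$ with children $N_1,N_2$, run $\textsc{FindPair}(N_1,N_2)$, where $\textsc{FindPair}(P,P')$ first swaps $P,P'$ if $\mathrm{diam}(P)<\mathrm{diam}(P')$, then records the pair $(P,P')$ in $S$ if $P$ and $P'$ are well-separated (in the sense defined in the context), and otherwise calls $\textsc{FindPair}(P_{\mathrm{left}},P')$ and $\textsc{FindPair}(P_{\mathrm{right}},P')$ on the two children of $P$. For each pair $(A,B)\in S$, let $(u^*,v^* )$ with $u^*\in A$, $v^*\in B$ be a pair minimizing the mutual reachability distance $d_m(u,v)$ over $u\in A$, $v\in B$, and let $G'$ be the graph on $\mathcal{P}$ containing exactly these edges $(u^*,v^* )$, one for each pair in $S$, each weighted by $d_m(u^*,v^* )$. Then every minimum spanning tree of $G'$ is a minimum spanning tree of the mutual reachability graph $G_{MR}$ of $\mathcal{P}$.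
   Context: $d(p,q)$ is the Euclidean distance. The core distance $\textsf{cd}(p)$ of a point $p\in\mathcal{P}$ is the distance from $p$ to its $\textsf{minPts}$-nearest neighbor in $\mathcal{P}$ (counting $p$ itself as its own first nearest neighbor). The mutual reachability distance is $d_m(p,q)=\max\{\textsf{cd}(p),\textsf{cd}(q),d(p,q)\}$, and the mutual reachability graph $G_{MR}$ is the complete undirected graph on $\mathcal{P}$ with edge weights $d_m$. For a tree node (point set) $A$, $\mathrm{diam}(A)$ is the diameter of the bounding sphere of $A$, $\textsf{cd}_{\min}(A)$ and $\textsf{cd}_{\max}(A)$ are the minimum and maximum core distances of points of $A$, and for two nodes $A,B$, $d(A,B)$ is the minimum distance between the bounding spheres of $A$ and $B$. Nodes $A$ and $B$ are geometrically-separated if $d(A,B)\geq\max\{\mathrm{diam}(A),\mathrm{diam}(B)\}$, and mutually-unreachable if $\max\{d(A,B),\textsf{cd}_{\min}(A),\textsf{cd}_{\min}(B)\}\geq\max\{\mathrm{diam}(A),\mathrm{diam}(B),\textsf{cd}_{\max}(A),\textsf{cd}_{\max}(B)\}$. $A$ and $B$ are called well-separated if they are geometrically-separated or mutually-unreachable (or both). *)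

theory Defs
  imports "HOL-Analysis.Analysis" "HOL-Library.Multiset"
begin

section \<open>Core distance and mutual reachability distance\<close>

text \<open>The \<open>k\<close>-th smallest of the distances from \<open>p\<close> to the points of \<open>P\<close>. For
  \<open>p \<in> P\<close> the point itself contributes the distance \<open>0\<close>, so it is its own first neighbour.
  The value is meaningful for \<open>1 \<le> k \<le> card P\<close>.\<close>

definition core_dist :: "'a::metric_space set \<Rightarrow> nat \<Rightarrow> 'a \<Rightarrow> real" where
  "core_dist P k p = sorted_list_of_multiset (image_mset (dist p) (mset_set P)) ! (k - 1)"

definition mreach_dist :: "('a::metric_space \<Rightarrow> real) \<Rightarrow> 'a \<Rightarrow> 'a \<Rightarrow> real" where
  "mreach_dist cd p q = max (max (cd p) (cd q)) (dist p q)"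


section \<open>Bounding spheres and separation of point sets\<close>

definition is_bounding_ball :: "'a::euclidean_space set \<Rightarrow> 'a set \<Rightarrow> bool" where
  "is_bounding_ball A B \<longleftrightarrow>
    (\<exists>c r. 0 \<le> r \<and> B = cball c r \<and> A \<subseteq> B \<and> (\<forall>c' r'. A \<subseteq> cball c' r' \<longrightarrow> r \<le> r'))"

text \<open>The bounding sphere is the smallest enclosing one, represented by the closed ball it bounds.
  In particular, spheres that intersect or are nested have distance \<open>0\<close>.\<close>

definition bounding_ball :: "'a::euclidean_space set \<Rightarrow> 'a set" where
  "bounding_ball A = (THE B. is_bounding_ball A B)"

lemma bounding_ball_exists_unique:
  fixes A :: "'a::euclidean_space set"
  assumes "finite A" "A \<noteq> {}"
  shows "\<exists>!B. is_bounding_ball A B"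
proof -
  define f where "f c = Max ((\<lambda>a. dist c a) ` A)" for c
  have fle: "f c \<le> r \<longleftrightarrow> A \<subseteq> cball c r" for c r
    using assms by (auto simp: f_def)
  have fge: "a \<in> A \<Longrightarrow> dist c a \<le> f c" for a c
    using assms by (simp add: f_def)
  have lip: "f c \<le> f c' + dist c c'" for c c'
  proof -
    have "A \<subseteq> cball c (f c' + dist c c')"
    proof
      fix a assume "a \<in> A"
      then have "dist c' a \<le> f c'" by (rule fge)
      moreover have "dist c a \<le> dist c c' + dist c' a" by (rule dist_triangle)
      ultimately show "a \<in> cball c (f c' + dist c c')" by simp
    qed
    then show ?thesis using fle by blast
  qed
  have cont: "continuous_on S f" for S
    unfolding continuous_on_iff
  proof (intro ballI allI impI)
    fix x e assume "x \<in> S" "(0::real) < e"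
    have "dist (f x') (f x) < e" if "dist x' x < e" for x'
      using lip[of x' x] lip[of x x'] that by (simp add: dist_real_def dist_commute abs_if)
    then show "\<exists>d>0. \<forall>x'\<in>S. dist x' x < d \<longrightarrow> dist (f x') (f x) < e"
      using \<open>0 < e\<close> by blast
  qed
  obtain a where a: "a \<in> A" using assms by blast
  have nn: "0 \<le> f c" for c using fge[OF a, of c] zero_le_dist[of c a] by linarith
  obtain c0 where c0: "c0 \<in> cball a (f a)" "\<And>c. c \<in> cball a (f a) \<Longrightarrow> f c0 \<le> f c"
  proof -
    have "cball a (f a) \<noteq> {}" using nn[of a] by simp
    from continuous_attains_inf[OF compact_cball this cont] show ?thesis
      using that by blast
  qed
  have min0: "f c0 \<le> f c" for c
  proof (cases "c \<in> cball a (f a)")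
    case True then show ?thesis using c0 by blast
  next
    case False
    then have "f a \<le> f c" using fge[OF a, of c] by (simp add: dist_commute)
    moreover have "f c0 \<le> f a" using c0(2)[of a] nn[of a] by simp
    ultimately show ?thesis by linarith
  qed
  have ex: "is_bounding_ball A (cball c0 (f c0))"
    unfolding is_bounding_ball_def
  proof (intro exI conjI allI impI)
    show "0 \<le> f c0" by (rule nn)
    show "A \<subseteq> cball c0 (f c0)" by (simp flip: fle)
    fix c r assume "A \<subseteq> cball c r"
    then have "f c \<le> r" by (simp add: fle)
    then show "f c0 \<le> r" using min0[of c] by linarith
  qed (rule refl)
  have uniq: "B = B'" if BB: "is_bounding_ball A B" "is_bounding_ball A B'" for B B'
  proof -
    obtain c r where c: "0 \<le> r" "B = cball c r" "A \<subseteq> cball c r"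
        and cmin: "\<And>c' r'. A \<subseteq> cball c' r' \<Longrightarrow> r \<le> r'"
      using BB(1) unfolding is_bounding_ball_def by blast
    obtain c' r' where c': "B' = cball c' r'" "A \<subseteq> cball c' r'"
        and c'min: "\<And>d s. A \<subseteq> cball d s \<Longrightarrow> r' \<le> s"
      using BB(2) unfolding is_bounding_ball_def by blast
    have r: "r' = r" using cmin[OF c'(2)] c'min[OF c(3)] by simp
    define m where "m = (1/2) *\<^sub>R (c + c')"
    define s where "s = sqrt (r\<^sup>2 - (norm (c - c'))\<^sup>2 / 4)"
    have sq: "(dist m x)\<^sup>2 \<le> r\<^sup>2 - (norm (c - c'))\<^sup>2 / 4" if "x \<in> A" for x
    proof -
      have "dist c x \<le> r" "dist c' x \<le> r" using that c c' r by auto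
      then have "(norm (c - x))\<^sup>2 \<le> r\<^sup>2" "(norm (c' - x))\<^sup>2 \<le> r\<^sup>2"
        by (simp_all add: dist_norm power_mono)
      moreover have "(norm (m - x))\<^sup>2 =
          (norm (c - x))\<^sup>2 / 2 + (norm (c' - x))\<^sup>2 / 2 - (norm (c - c'))\<^sup>2 / 4"
        unfolding m_def power2_norm_eq_inner
        by (simp add: inner_simps inner_commute field_simps)
      ultimately show ?thesis by (simp add: dist_norm)
    qed
    have "A \<subseteq> cball m s"
      using sq by (auto simp: s_def intro!: real_le_rsqrt)
    then have "r \<le> s" by (rule cmin)
    moreover have "0 \<le> r\<^sup>2 - (norm (c - c'))\<^sup>2 / 4"
      using sq[OF a] zero_le_power2[of "dist m a"] by linarith
    ultimately have "r\<^sup>2 \<le> r\<^sup>2 - (norm (c - c'))\<^sup>2 / 4"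
      using c(1) by (metis power_mono real_sqrt_pow2 s_def)
    then have "c = c'" by simp
    then show ?thesis using c c' r by simp
  qed
  show ?thesis using ex uniq by blast
qed

definition node_diam :: "'a::euclidean_space set \<Rightarrow> real" where
  "node_diam A = diameter (bounding_ball A)"

definition node_dist :: "'a::euclidean_space set \<Rightarrow> 'a set \<Rightarrow> real" where
  "node_dist A B = setdist (bounding_ball A) (bounding_ball B)"

definition cd_min :: "('a \<Rightarrow> real) \<Rightarrow> 'a set \<Rightarrow> real" where
  "cd_min cd A = Min (cd ` A)"

definition cd_max :: "('a \<Rightarrow> real) \<Rightarrow> 'a set \<Rightarrow> real" where
  "cd_max cd A = Max (cd ` A)"

definition geometrically_separated :: "'a::euclidean_space set \<Rightarrow> 'a set \<Rightarrow> bool" where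
  "geometrically_separated A B \<longleftrightarrow> node_dist A B \<ge> max (node_diam A) (node_diam B)"

definition mutually_unreachable ::
  "('a::euclidean_space \<Rightarrow> real) \<Rightarrow> 'a set \<Rightarrow> 'a set \<Rightarrow> bool" where
  "mutually_unreachable cd A B \<longleftrightarrow>
     Max {node_dist A B, cd_min cd A, cd_min cd B}
       \<ge> Max {node_diam A, node_diam B, cd_max cd A, cd_max cd B}"

definition well_separated ::
  "('a::euclidean_space \<Rightarrow> real) \<Rightarrow> 'a set \<Rightarrow> 'a set \<Rightarrow> bool" where
  "well_separated cd A B \<longleftrightarrow> geometrically_separated A B \<or> mutually_unreachable cd A B"


section \<open>The tree and the pair decomposition\<close>

text \<open>A node is identified with the subtree rooted at it; its point set is \<open>points\<close> of that
  subtree, so that the point set of an internal node is by construction the union of those of its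
  children.\<close>

datatype 'a ptree = Leaf 'a | Branch "'a ptree" "'a ptree"

fun leaves :: "'a ptree \<Rightarrow> 'a list" where
  "leaves (Leaf p) = [p]"
| "leaves (Branch L R) = leaves L @ leaves R"

definition points :: "'a ptree \<Rightarrow> 'a set" where
  "points T = set (leaves T)"

fun nodes :: "'a ptree \<Rightarrow> 'a ptree set" where
  "nodes (Leaf p) = {Leaf p}"
| "nodes (Branch L R) = insert (Branch L R) (nodes L \<union> nodes R)"

text \<open>Every point of \<open>P\<close> occurs at exactly one leaf.\<close>

definition is_tree_on :: "'a ptree \<Rightarrow> 'a set \<Rightarrow> bool" where
  "is_tree_on T P \<longleftrightarrow> distinct (leaves T) \<and> points T = P"

text \<open>The recursive call in the first branch performs the swap. A leaf has diameter \<open>0\<close>, and a node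
  with at least two points has positive diameter. Hence when the last branch is reached, \<open>A\<close> is
  internal, and the value chosen for \<open>Leaf\<close> is irrelevant.\<close>

function find_pair ::
  "('a::euclidean_space \<Rightarrow> real) \<Rightarrow> 'a ptree \<Rightarrow> 'a ptree \<Rightarrow> ('a ptree \<times> 'a ptree) set" where
  "find_pair cd A B =
    (if node_diam (points A) < node_diam (points B) then find_pair cd B A
     else if well_separated cd (points A) (points B) then {(A, B)}
     else (case A of Leaf p \<Rightarrow> {} | Branch L R \<Rightarrow> find_pair cd L B \<union> find_pair cd R B))"
  by pat_completeness auto
termination
  by (relation "measures [\<lambda>(cd, A, B). size A + size B,
        \<lambda>(cd, A, B). if node_diam (points A) < node_diam (points B) then 1 else 0]") auto

declare find_pair.simps [simp del]

definition pair_decomposition ::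
  "('a::euclidean_space \<Rightarrow> real) \<Rightarrow> 'a ptree \<Rightarrow> ('a ptree \<times> 'a ptree) set" where
  "pair_decomposition cd T = \<Union> {find_pair cd L R | L R. Branch L R \<in> nodes T}"

definition is_closest_pair :: "('a \<Rightarrow> 'a \<Rightarrow> real) \<Rightarrow> 'a set \<Rightarrow> 'a set \<Rightarrow> 'a \<Rightarrow> 'a \<Rightarrow> bool" where
  "is_closest_pair w A B u v \<longleftrightarrow> u \<in> A \<and> v \<in> B \<and> (\<forall>u'\<in>A. \<forall>v'\<in>B. w u v \<le> w u' v')"


section \<open>Undirected graphs and minimum spanning trees\<close>

definition is_graph :: "'a set \<Rightarrow> 'a set set \<Rightarrow> bool" where
  "is_graph V E \<longleftrightarrow> (\<forall>e\<in>E. e \<subseteq> V \<and> card e = 2)"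

definition graph_connected :: "'a set \<Rightarrow> 'a set set \<Rightarrow> bool" where
  "graph_connected V E \<longleftrightarrow> (\<forall>u\<in>V. \<forall>v\<in>V. (u, v) \<in> {(x, y). {x, y} \<in> E}\<^sup>*)"

definition is_cycle :: "'a set set \<Rightarrow> 'a list \<Rightarrow> bool" where
  "is_cycle E vs \<longleftrightarrow> length vs \<ge> 3 \<and> distinct vs \<and>
     (\<forall>i < length vs. {vs ! i, vs ! ((i + 1) mod length vs)} \<in> E)"

definition is_spanning_tree :: "'a set \<Rightarrow> 'a set set \<Rightarrow> 'a set set \<Rightarrow> bool" where
  "is_spanning_tree V E F \<longleftrightarrow>
     F \<subseteq> E \<and> is_graph V F \<and> graph_connected V F \<and> (\<nexists>vs. is_cycle F vs)"

text \<open>Weight of an undirected edge under a symmetric weight function on pairs of points.\<close>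

definition edge_weight :: "('a \<Rightarrow> 'a \<Rightarrow> real) \<Rightarrow> 'a set \<Rightarrow> real" where
  "edge_weight w e = (THE x. \<exists>u v. e = {u, v} \<and> x = w u v)"

definition is_mst :: "'a set \<Rightarrow> 'a set set \<Rightarrow> ('a \<Rightarrow> 'a \<Rightarrow> real) \<Rightarrow> 'a set set \<Rightarrow> bool" where
  "is_mst V E w F \<longleftrightarrow> is_spanning_tree V E F \<and>
     (\<forall>F'. is_spanning_tree V E F' \<longrightarrow> sum (edge_weight w) F \<le> sum (edge_weight w) F')"

definition complete_edges :: "'a set \<Rightarrow> 'a set set" where
  "complete_edges V = {{u, v} | u v. u \<in> V \<and> v \<in> V \<and> u \<noteq> v}"

end

theory Submission imports Defs begin

text \<open>For all \<open>u\<close>, \<open>v\<close> in a tree node, the graph \<open>G'\<close> contains a path from \<open>u\<close> to \<open>v\<close> whose edges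
  weigh at most \<open>d_m u v\<close>: if \<open>u\<close> and \<open>v\<close> lie in different children, they are covered by some
  well-separated pair \<open>(A, B)\<close>, and separation gives \<open>d_m u u\<^sup>* \<le> d_m u v\<close> and
  \<open>d_m v v\<^sup>* \<le> d_m u v\<close>, so that the path through the edge \<open>{u\<^sup>*, v\<^sup>*}\<close> is obtained by induction
  inside the two children. A minimum spanning tree of \<open>G'\<close> inherits this bottleneck property, and
  a spanning tree with the bottleneck property for all edges of a graph is a minimum spanning tree
  of that graph, by edge exchange.\<close>

section \<open>Reachability and edge exchange\<close>

definition reach :: "'a set set \<Rightarrow> ('a \<times> 'a) set" where
  "reach E = {(x, y). {x, y} \<in> E}\<^sup>*"

text \<open>Acyclicity stated edge by edge: every edge is a bridge. Unlike the absence of cyclic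
  vertex lists, this form can be checked directly after an edge exchange. It also excludes loops,
  since \<open>x\<close> always reaches itself.\<close>

definition bridges_only :: "'a set set \<Rightarrow> bool" where
  "bridges_only F \<longleftrightarrow> (\<forall>x y. {x, y} \<in> F \<longrightarrow> (x, y) \<notin> reach (F - {{x, y}}))"

lemma graph_connected_iff: "graph_connected V E \<longleftrightarrow> (\<forall>u\<in>V. \<forall>v\<in>V. (u, v) \<in> reach E)"
  unfolding graph_connected_def reach_def ..

lemma reach_refl [simp]: "(x, x) \<in> reach E"
  by (simp add: reach_def)

lemma reach_trans: "(x, y) \<in> reach E \<Longrightarrow> (y, z) \<in> reach E \<Longrightarrow> (x, z) \<in> reach E"
  unfolding reach_def by (rule rtrancl_trans)

lemma reach_edge: "{x, y} \<in> E \<Longrightarrow> (x, y) \<in> reach E"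
  unfolding reach_def by (rule r_into_rtrancl) simp

lemma reach_sym: "(x, y) \<in> reach E \<Longrightarrow> (y, x) \<in> reach E"
proof -
  have "sym {(x, y). {x, y} \<in> E}" by (auto simp: sym_def insert_commute)
  then show "(x, y) \<in> reach E \<Longrightarrow> (y, x) \<in> reach E"
    unfolding reach_def by (meson sym_rtrancl symD)
qed

lemma reach_induct [consumes 1, case_names base step]:
  assumes "(u, v) \<in> reach E" "Q u"
    and "\<And>v w. (u, v) \<in> reach E \<Longrightarrow> {v, w} \<in> E \<Longrightarrow> Q v \<Longrightarrow> Q w"
  shows "Q v"
  using assms(1)[unfolded reach_def]
proof (induction rule: rtrancl_induct)
  case base
  show ?case by (rule assms(2))
next
  case (step v w)
  then show ?case using assms(3)[of v w] by (simp add: reach_def)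
qed

lemma reach_mono: "(x, y) \<in> reach E \<Longrightarrow> E \<subseteq> E' \<Longrightarrow> (x, y) \<in> reach E'"
  unfolding reach_def by (rule subsetD[OF rtrancl_mono]) auto

lemma reach_lift:
  assumes "(u, v) \<in> reach E" and "\<And>x y. {x, y} \<in> E \<Longrightarrow> (x, y) \<in> reach E'"
  shows "(u, v) \<in> reach E'"
  using assms(1)
proof (induction rule: reach_induct)
  case (step v w)
  show ?case by (rule reach_trans[OF step(3) assms(2)[OF step(2)]])
qed simp

text \<open>One crossing of the new edge suffices: in the induction, a further step across it either
  begins the crossing, repeats it, or returns to an end already reached within
  \<open>E\<close>.\<close>

lemma reach_insert:
  assumes "(u, v) \<in> reach (insert {x, y} E)"
  shows "(u, v) \<in> reach E \<or> (u, x) \<in> reach E \<and> (y, v) \<in> reach E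
    \<or> (u, y) \<in> reach E \<and> (x, v) \<in> reach E"
  using assms
proof (induction rule: reach_induct)
  case base
  then show ?case by simp
next
  case (step v w)
  then consider "{v, w} \<in> E" | "v = x" "w = y" | "v = y" "w = x"
    by (auto simp: doubleton_eq_iff)
  then show ?case
  proof cases
    case 1
    then show ?thesis using step.IH reach_trans reach_edge by metis
  next
    case 2
    then show ?thesis using step.IH reach_refl by metis
  next
    case 3
    then show ?thesis using step.IH reach_refl by metis
  qed
qed

text \<open>Since \<open>{x, y}\<close> is what joins \<open>u\<close> to \<open>v\<close> on top of
  \<open>E\<close>, one of its ends hangs on \<open>u\<close> and the other on \<open>v\<close>
  within \<open>E\<close>. Any other connection of \<open>u\<close> and \<open>v\<close> then closes
  a detour around \<open>{x, y}\<close>. Both halves of the exchange argument rest on this.\<close>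

lemma reach_critical_ends:
  assumes "(u, v) \<in> reach (insert {x, y} E)" "(u, v) \<notin> reach E"
    and "(u, v) \<in> reach E'" "E \<subseteq> E'"
  shows "(x, y) \<in> reach E'"
proof -
  have up: "(p, q) \<in> reach E'" if "(p, q) \<in> reach E" for p q
    using that assms(4) by (rule reach_mono)
  from reach_insert[OF assms(1)] assms(2)
  consider "(u, x) \<in> reach E" "(y, v) \<in> reach E" | "(u, y) \<in> reach E" "(x, v) \<in> reach E"
    by blast
  then show ?thesis
  proof cases
    case 1
    then show ?thesis using reach_trans[OF reach_sym reach_trans[OF assms(3) reach_sym]] up by blast
  next
    case 2
    then show ?thesis using reach_trans[OF _ reach_trans[OF reach_sym[OF assms(3)]]] up by blast
  qed
qed

lemma reach_leaves_set:
  assumes "(u, v) \<in> reach E" "u \<in> C" "v \<notin> C"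
  shows "\<exists>x y. {x, y} \<in> E \<and> x \<in> C \<and> y \<notin> C"
  using assms by (induction rule: reach_induct) auto

text \<open>Insert the edges of \<open>D\<close> one at a time; \<open>d\<close> is the first whose
  insertion joins \<open>u\<close> to \<open>v\<close>, and \<open>D'\<close> collects the edges
  inserted before it.\<close>

lemma reach_critical_edge:
  assumes "finite D" "(u, v) \<in> reach (E \<union> D)" "(u, v) \<notin> reach E"
  obtains D' d where "D' \<subseteq> D" "d \<in> D - D'" "(u, v) \<notin> reach (E \<union> D')"
    "(u, v) \<in> reach (insert d (E \<union> D'))"
proof -
  from assms have "\<exists>D' d. D' \<subseteq> D \<and> d \<in> D - D' \<and> (u, v) \<notin> reach (E \<union> D')
    \<and> (u, v) \<in> reach (insert d (E \<union> D'))"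
  proof (induction rule: finite_induct)
    case empty
    then show ?case by simp
  next
    case (insert d D)
    show ?case
    proof (cases "(u, v) \<in> reach (E \<union> D)")
      case True
      then show ?thesis using insert by blast
    next
      case False
      moreover have "(u, v) \<in> reach (insert d (E \<union> D))" using insert.prems(1) by simp
      ultimately show ?thesis using insert.hyps(2) by blast
    qed
  qed
  with that show thesis by blast
qed

section \<open>Simple paths, cycles and bridges\<close>

lemma simple_path:
  assumes "(x, y) \<in> reach E"
  shows "\<exists>vs. vs \<noteq> [] \<and> hd vs = x \<and> last vs = y \<and> distinct vs
    \<and> (\<forall>i. Suc i < length vs \<longrightarrow> {vs ! i, vs ! Suc i} \<in> E)"
  using assms
proof (induction rule: reach_induct)
  case base
  show ?case by (rule exI[of _ "[x]"]) simp
next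
  case (step y z)
  then obtain vs where vs: "vs \<noteq> []" "hd vs = x" "last vs = y" "distinct vs"
    "\<And>i. Suc i < length vs \<Longrightarrow> {vs ! i, vs ! Suc i} \<in> E" by blast
  show ?case
  proof (cases "z \<in> set vs")
    case True
    \<comment> \<open>The walk returns to a vertex already visited, so the path is cut back to its
      occurrence at position \<open>j\<close>.\<close>
    then obtain j where j: "j < length vs" "vs ! j = z" by (auto simp: in_set_conv_nth)
    have "last (take (Suc j) vs) = z" using j by (simp add: take_Suc_conv_app_nth)
    then show ?thesis using vs j
      by (intro exI[of _ "take (Suc j) vs"]) auto
  next
    case False
    have "{(vs @ [z]) ! i, (vs @ [z]) ! Suc i} \<in> E" if "Suc i < length (vs @ [z])" for i
    proof (cases "Suc i < length vs")
      case True
      then show ?thesis using vs(5)[of i] by (simp add: nth_append)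
    next
      case False
      then have "i = length vs - 1" using that by simp
      then show ?thesis using vs(1,3) step.hyps(2) by (simp add: nth_append last_conv_nth)
    qed
    then show ?thesis using vs False by (intro exI[of _ "vs @ [z]"]) auto
  qed
qed

lemma acyclic_iff_bridges_only:
  assumes "is_graph V F"
  shows "(\<nexists>vs. is_cycle F vs) \<longleftrightarrow> bridges_only F"
proof
  assume nc: "\<nexists>vs. is_cycle F vs"
  show "bridges_only F"
    unfolding bridges_only_def
  proof (intro allI impI notI)
    fix x y assume xy: "{x, y} \<in> F" and r: "(x, y) \<in> reach (F - {{x, y}})"
    obtain vs where vs: "vs \<noteq> []" "hd vs = x" "last vs = y" "distinct vs"
      "\<And>i. Suc i < length vs \<Longrightarrow> {vs ! i, vs ! Suc i} \<in> F - {{x, y}}"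
      using simple_path[OF r] by blast
    have "x \<noteq> y" using assms xy by (auto simp: is_graph_def)
    have ends: "vs ! 0 = x" "vs ! (length vs - 1) = y"
      using vs by (simp_all add: hd_conv_nth last_conv_nth)
    \<comment> \<open>Length 1 would force \<open>x = y\<close>, and length 2 would make
      \<open>{x, y}\<close> an edge of the graph from which it was removed.\<close>
    have "length vs \<noteq> 0" "length vs \<noteq> 1" "length vs \<noteq> 2"
      using vs(1) ends \<open>x \<noteq> y\<close> vs(5)[of 0] by auto
    then have "length vs \<ge> 3" by linarith
    moreover have "{vs ! i, vs ! ((i + 1) mod length vs)} \<in> F" if "i < length vs" for i
    proof (cases "Suc i < length vs")
      case True
      then show ?thesis using vs(5)[of i] by simp
    next
      case False
      then have "i = length vs - 1" using that by simp
      then show ?thesis using ends xy vs(1) by (simp add: insert_commute)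
    qed
    ultimately show False using nc vs(4) unfolding is_cycle_def by blast
  qed
next
  assume br: "bridges_only F"
  show "\<nexists>vs. is_cycle F vs"
  proof
    assume "\<exists>vs. is_cycle F vs"
    then obtain vs where len: "length vs \<ge> 3" and dist: "distinct vs"
      and ed: "\<And>i. i < length vs \<Longrightarrow> {vs ! i, vs ! ((i + 1) mod length vs)} \<in> F"
      unfolding is_cycle_def by blast
    define n where "n = length vs - 1"
    have n: "Suc n = length vs" "n \<ge> 2" using len by (auto simp: n_def)
    have inj: "vs ! i = vs ! j \<longleftrightarrow> i = j" if "i \<le> n" "j \<le> n" for i j
      using that n dist by (simp add: nth_eq_iff_index_eq)
    have last: "{vs ! 0, vs ! n} \<in> F"
      using ed[of n] n by (simp add: insert_commute)
    \<comment> \<open>Walking along the list from its first to its last vertex avoids the closing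
      edge, so that edge is not a bridge.\<close>
    have "(vs ! 0, vs ! i) \<in> reach (F - {{vs ! 0, vs ! n}})" if "i \<le> n" for i
      using that
    proof (induction i)
      case 0
      then show ?case by simp
    next
      case (Suc i)
      have "{vs ! i, vs ! Suc i} \<in> F" using ed[of i] Suc.prems n by simp
      \<comment> \<open>Equality would require \<open>i = 0\<close> and \<open>Suc i = n\<close>,
        which \<open>n \<ge> 2\<close> excludes.\<close>
      moreover have "{vs ! i, vs ! Suc i} \<noteq> {vs ! 0, vs ! n}"
        using inj[of i 0] inj[of i n] inj[of "Suc i" n] n Suc.prems by (auto simp: doubleton_eq_iff)
      ultimately have "(vs ! i, vs ! Suc i) \<in> reach (F - {{vs ! 0, vs ! n}})"
        by (intro reach_edge) blast
      moreover have "(vs ! 0, vs ! i) \<in> reach (F - {{vs ! 0, vs ! n}})"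
        by (rule Suc.IH) (use Suc.prems in simp)
      ultimately show ?case by (rule reach_trans[rotated])
    qed
    then show False using br last unfolding bridges_only_def by blast
  qed
qed

section \<open>Spanning trees and edge exchange\<close>

lemma spanning_tree_iff:
  "is_spanning_tree V E F \<longleftrightarrow>
    F \<subseteq> E \<and> is_graph V F \<and> graph_connected V F \<and> bridges_only F"
  unfolding is_spanning_tree_def using acyclic_iff_bridges_only[of V F] by argo

lemma graph_edge_cases:
  assumes "is_graph V F" "e \<in> F"
  obtains x y where "e = {x, y}" "x \<noteq> y" "x \<in> V" "y \<in> V"
proof -
  from assms have "e \<subseteq> V" "card e = 2" by (auto simp: is_graph_def)
  then obtain x y where "e = {x, y}" "x \<noteq> y" by (auto simp: card_2_iff)
  with \<open>e \<subseteq> V\<close> show thesis by (intro that) auto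
qed

lemma finite_graph: "finite V \<Longrightarrow> is_graph V F \<Longrightarrow> finite F"
  unfolding is_graph_def by (rule finite_subset[of _ "Pow V"]) auto

lemma spanning_tree_exchange:
  assumes F: "is_spanning_tree V E F"
    and e: "{a, b} \<in> E" "a \<in> V" "b \<in> V"
    and g: "{x, y} \<in> F" and sep: "(a, b) \<notin> reach (F - {{x, y}})"
  shows "is_spanning_tree V E (insert {a, b} (F - {{x, y}}))"
proof -
  define X where "X = F - {{x, y}}"
  have FX: "F = insert {x, y} X" using g by (auto simp: X_def)
  have sub: "F \<subseteq> E" and gr: "is_graph V F" and conn: "graph_connected V F"
    and br: "bridges_only F"
    using F by (auto simp: spanning_tree_iff)
  have sep: "(a, b) \<notin> reach X" using sep by (simp add: X_def)
  then have "a \<noteq> b" by auto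
  let ?F = "insert {a, b} X"
  have "(a, b) \<in> reach (insert {x, y} X)"
    using conn e by (simp add: graph_connected_iff FX)
  \<comment> \<open>The removed edge is critical for \<open>a\<close> and \<open>b\<close> over
    \<open>X\<close>; the new edge joins \<open>a\<close> and \<open>b\<close>, hence also bypasses
    the removed one.\<close>
  from this sep have xy: "(x, y) \<in> reach ?F"
    by (rule reach_critical_ends) (auto intro: reach_edge)
  have "(u, v) \<in> reach ?F" if "(u, v) \<in> reach F" for u v
    using that
  proof (rule reach_lift)
    fix p q assume "{p, q} \<in> F"
    then consider "{p, q} \<in> X" | "p = x" "q = y" | "p = y" "q = x"
      by (auto simp: FX doubleton_eq_iff)
    then show "(p, q) \<in> reach ?F"
      using xy reach_sym[OF xy] by cases (auto intro: reach_edge)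
  qed
  then have "graph_connected V ?F" using conn by (simp add: graph_connected_iff)
  moreover have "is_graph V ?F"
    using gr e \<open>a \<noteq> b\<close> by (auto simp: is_graph_def X_def)
  moreover have "bridges_only ?F"
    unfolding bridges_only_def
  proof (intro allI impI notI)
    fix p q assume pq: "{p, q} \<in> ?F" and r: "(p, q) \<in> reach (?F - {{p, q}})"
    show False
    proof (cases "{p, q} = {a, b}")
      case True
      then have "(p, q) \<in> reach X" using r by (elim reach_mono) auto
      moreover have "p = a \<and> q = b \<or> p = b \<and> q = a" using True by (auto simp: doubleton_eq_iff)
      ultimately show False using sep reach_sym by metis
    next
      case False
      \<comment> \<open>A detour around an old edge \<open>{p, q}\<close> must use the new edge, as
        \<open>{p, q}\<close> was a bridge before. So \<open>{a, b}\<close> is critical for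
        \<open>p\<close> and \<open>q\<close> over \<open>?Y\<close>, and restoring
        \<open>{p, q}\<close> would join \<open>a\<close> to \<open>b\<close> inside
        \<open>X\<close>.\<close>
      let ?Y = "X - {{p, q}}"
      from False have pqX: "{p, q} \<in> X" using pq by auto
      from False have "?F - {{p, q}} = insert {a, b} ?Y" by auto
      with r have "(p, q) \<in> reach (insert {a, b} ?Y)" by simp
      moreover have "(p, q) \<notin> reach ?Y"
      proof
        assume "(p, q) \<in> reach ?Y"
        then have "(p, q) \<in> reach (F - {{p, q}})" by (rule reach_mono) (auto simp: X_def)
        then show False using br pqX by (auto simp: bridges_only_def X_def)
      qed
      ultimately have "(a, b) \<in> reach X"
        by (rule reach_critical_ends) (use pqX in \<open>auto intro: reach_edge\<close>)
      with sep show False by contradiction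
    qed
  qed
  moreover have "?F \<subseteq> E" using sub e by (auto simp: X_def)
  ultimately show ?thesis by (simp add: spanning_tree_iff X_def)
qed

section \<open>Minimum spanning trees and bottleneck paths\<close>

abbreviation edges_upto :: "('a \<Rightarrow> 'a \<Rightarrow> real) \<Rightarrow> real \<Rightarrow> 'a set set \<Rightarrow> 'a set set" where
  "edges_upto w t F \<equiv> {e \<in> F. edge_weight w e \<le> t}"

lemma edge_weight_doubleton:
  assumes "\<And>u v. w u v = w v u"
  shows "edge_weight w {u, v} = w u v"
  unfolding edge_weight_def using assms by (intro the_equality) (auto simp: doubleton_eq_iff)

lemma sum_exchange:
  fixes h :: "'b \<Rightarrow> real"
  assumes "finite F" "g \<in> F" "e \<notin> F - {g}"
  shows "sum h (insert e (F - {g})) = sum h F - h g + h e"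
  using assms sum.remove[of F g h] by simp

text \<open>Otherwise the tree path from \<open>a\<close> to \<open>b\<close> has an edge heavier
  than \<open>{a, b}\<close>, and exchanging the two would produce a lighter spanning tree.\<close>

lemma mst_bottleneck:
  assumes "finite V" and mst: "is_mst V E w F"
    and e: "{a, b} \<in> E" "a \<in> V" "b \<in> V"
  shows "(a, b) \<in> reach (edges_upto w (edge_weight w {a, b}) F)"
proof (rule ccontr)
  let ?t = "edge_weight w {a, b}"
  let ?L = "edges_upto w ?t F" and ?H = "{e \<in> F. edge_weight w e > ?t}"
  assume nr: "(a, b) \<notin> reach ?L"
  have st: "is_spanning_tree V E F"
    and min: "\<And>F'. is_spanning_tree V E F' \<Longrightarrow> sum (edge_weight w) F \<le> sum (edge_weight w) F'"
    using mst by (auto simp: is_mst_def)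
  then have gr: "is_graph V F" and conn: "graph_connected V F" and br: "bridges_only F"
    by (auto simp: spanning_tree_iff)
  have fin: "finite F" using \<open>finite V\<close> gr by (rule finite_graph)
  have "?L \<union> ?H = F" by auto
  then have "(a, b) \<in> reach (?L \<union> ?H)" using conn e by (simp add: graph_connected_iff)
  \<comment> \<open>Starting from the light edges and adding heavy ones singly locates a heavy edge
    \<open>g\<close> of the tree path.\<close>
  then obtain D g where D: "D \<subseteq> ?H" "g \<in> ?H - D" "(a, b) \<notin> reach (?L \<union> D)"
    "(a, b) \<in> reach (insert g (?L \<union> D))"
    using reach_critical_edge[of ?H a b ?L] nr fin by auto
  then have gF: "g \<in> F" and heavy: "edge_weight w g > ?t" by auto
  obtain x y where g: "g = {x, y}" using gr gF by (rule graph_edge_cases)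
  have sub: "?L \<union> D \<subseteq> F - {g}" using D heavy by auto
  \<comment> \<open>A connection of \<open>a\<close> and \<open>b\<close> avoiding \<open>g\<close>
    would also join the ends of \<open>g\<close>, contradicting that \<open>g\<close> is a bridge of
    \<open>F\<close>.\<close>
  have sep: "(a, b) \<notin> reach (F - {g})"
  proof
    assume r: "(a, b) \<in> reach (F - {g})"
    have "(a, b) \<in> reach (insert {x, y} (?L \<union> D))" using D(4) g by simp
    from this D(3) r sub have "(x, y) \<in> reach (F - {g})" by (rule reach_critical_ends)
    then show False using br gF g by (auto simp: bridges_only_def)
  qed
  have eF: "{a, b} \<notin> F - {g}" using sep reach_edge by metis
  have "is_spanning_tree V E (insert {a, b} (F - {g}))"
    using spanning_tree_exchange[OF st e] gF sep g by simp
  from min[OF this] show False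
    using sum_exchange[OF fin gF eF, of "edge_weight w"] heavy by simp
qed

text \<open>Any competitor \<open>F'\<close> is moved towards \<open>F\<close> by exchanges that
  never increase its weight; each lowers the number of edges outside \<open>F\<close>.\<close>

lemma bottleneck_tree_minimal:
  assumes "finite V" and F: "is_spanning_tree V E F"
    and bott: "\<And>a b. {a, b} \<in> E \<Longrightarrow> a \<in> V \<Longrightarrow> b \<in> V
      \<Longrightarrow> (a, b) \<in> reach (edges_upto w (edge_weight w {a, b}) F)"
    and F': "is_spanning_tree V E F'"
  shows "sum (edge_weight w) F \<le> sum (edge_weight w) F'"
  using F'
proof (induction "card (F' - F)" arbitrary: F' rule: less_induct)
  case less
  have F: "F \<subseteq> E" "is_graph V F" "bridges_only F"
    using F by (auto simp: spanning_tree_iff)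
  have F': "F' \<subseteq> E" "is_graph V F'" "bridges_only F'" "graph_connected V F'"
    using less.prems by (auto simp: spanning_tree_iff)
  have fin: "finite F'" using \<open>finite V\<close> F'(2) by (rule finite_graph)
  show ?case
  proof (cases "F' \<subseteq> F")
    case True
    \<comment> \<open>A spanning tree inside another equals it: an edge missing from
      \<open>F'\<close> would be bypassed by \<open>F'\<close>, hence not be a bridge of
      \<open>F\<close>.\<close>
    have "g \<in> F'" if gF: "g \<in> F" for g
    proof (rule ccontr)
      assume "g \<notin> F'"
      obtain x y where g: "g = {x, y}" "x \<in> V" "y \<in> V"
        using F(2) gF by (rule graph_edge_cases)
      then have "(x, y) \<in> reach F'" using F'(4) by (simp add: graph_connected_iff)
      then have "(x, y) \<in> reach (F - {g})"
        by (rule reach_mono) (use True \<open>g \<notin> F'\<close> in auto)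
      then show False using F(3) gF g by (auto simp: bridges_only_def)
    qed
    then have "F = F'" using True by blast
    then show ?thesis by simp
  next
    case False
    then obtain e where eF: "e \<in> F'" "e \<notin> F" by blast
    obtain a b where e: "e = {a, b}" "a \<in> V" "b \<in> V"
      using F'(2) eF(1) by (rule graph_edge_cases)
    let ?X = "F' - {e}"
    have nab: "(a, b) \<notin> reach ?X" using F'(3) eF e by (auto simp: bridges_only_def)
    have "(a, b) \<in> reach (edges_upto w (edge_weight w e) F)"
      using bott e eF F'(1) by auto
    \<comment> \<open>Removing \<open>e\<close> cuts \<open>F'\<close>; the light
      \<open>F\<close>-path from \<open>a\<close> to \<open>b\<close> has to leave the component of
      \<open>a\<close>, and the edge where it does so is no heavier than \<open>e\<close> and
      reconnects the two sides.\<close>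
    from reach_leaves_set[OF this, of "{z. (a, z) \<in> reach ?X}"] nab
    obtain x y where f: "{x, y} \<in> F" "edge_weight w {x, y} \<le> edge_weight w e"
      "(a, x) \<in> reach ?X" "(a, y) \<notin> reach ?X"
      by auto
    have nxy: "(x, y) \<notin> reach ?X" using f(3,4) reach_trans by metis
    have xyV: "x \<in> V" "y \<in> V" using F(2) f(1) by (auto simp: is_graph_def)
    have fX: "{x, y} \<notin> ?X" using nxy reach_edge by metis
    let ?F'' = "insert {x, y} ?X"
    have st: "is_spanning_tree V E ?F''"
      using spanning_tree_exchange[OF less.prems, of x y a b] f(1) F(1) xyV eF e nxy by auto
    have "?F'' - F = (F' - F) - {e}" using f(1) by auto
    then have "card (?F'' - F) < card (F' - F)"
      using fin eF by (metis DiffI card_Diff1_less finite_Diff)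
    from less.hyps[OF this st]
    have "sum (edge_weight w) F \<le> sum (edge_weight w) ?F''" .
    also have "\<dots> \<le> sum (edge_weight w) F'"
      using sum_exchange[OF fin eF(1) fX, of "edge_weight w"] f(2) by simp
    finally show ?thesis .
  qed
qed

text \<open>Bottleneck paths compose: each edge of a light path in \<open>E'\<close> is replaced by
  a path in \<open>F\<close> that is no heavier, by \<open>mst_bottleneck\<close>. So
  \<open>F\<close> has the bottleneck property for all of \<open>E\<close>.\<close>

lemma mst_of_bottleneck_subgraph:
  assumes "finite V"
    and mst: "is_mst V E' w F"
    and sub: "F \<subseteq> E"
    and bott: "\<And>a b. {a, b} \<in> E \<Longrightarrow> a \<in> V \<Longrightarrow> b \<in> V
      \<Longrightarrow> (a, b) \<in> reach (edges_upto w (edge_weight w {a, b}) E')"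
    and E': "\<And>e. e \<in> E' \<Longrightarrow> e \<subseteq> V"
  shows "is_mst V E w F"
proof -
  have "is_spanning_tree V E F"
    using mst sub by (auto simp: is_mst_def is_spanning_tree_def)
  moreover have "(a, b) \<in> reach (edges_upto w (edge_weight w {a, b}) F)"
    if "{a, b} \<in> E" "a \<in> V" "b \<in> V" for a b
    using bott[OF that]
  proof (rule reach_lift)
    fix x y assume xy: "{x, y} \<in> edges_upto w (edge_weight w {a, b}) E'"
    then have "{x, y} \<in> E'" "x \<in> V" "y \<in> V" using E'[of "{x, y}"] by auto
    from mst_bottleneck[OF \<open>finite V\<close> mst this]
    show "(x, y) \<in> reach (edges_upto w (edge_weight w {a, b}) F)"
      by (rule reach_mono) (use xy in auto)
  qed
  ultimately show ?thesis
    unfolding is_mst_def using bottleneck_tree_minimal[OF \<open>finite V\<close>] by blast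
qed

section \<open>Well-separated pairs\<close>

lemma points_simps [simp]:
  "points (Leaf p) = {p}" "points (Branch L R) = points L \<union> points R"
  by (auto simp: points_def)

lemma finite_points [simp]: "finite (points A)"
  by (simp add: points_def)

lemma points_nonempty [simp]: "points A \<noteq> {}"
  by (induction A) simp_all

lemma node_in_nodes [simp]: "A \<in> nodes A"
  by (cases A) simp_all

lemma nodes_trans: "N \<in> nodes T \<Longrightarrow> M \<in> nodes N \<Longrightarrow> M \<in> nodes T"
  by (induction T) auto

section \<open>Bounding balls\<close>

lemma bounding_ball_is_bounding_ball:
  assumes "finite A" "A \<noteq> {}"
  shows "is_bounding_ball A (bounding_ball A)"
  unfolding bounding_ball_def using bounding_ball_exists_unique[OF assms] by (rule theI')

lemma subset_bounding_ball: "finite A \<Longrightarrow> A \<noteq> {} \<Longrightarrow> A \<subseteq> bounding_ball A"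
  using bounding_ball_is_bounding_ball unfolding is_bounding_ball_def by blast

lemma bounded_bounding_ball: "finite A \<Longrightarrow> A \<noteq> {} \<Longrightarrow> bounded (bounding_ball A)"
  using bounding_ball_is_bounding_ball unfolding is_bounding_ball_def by (metis bounded_cball)

lemma dist_le_node_diam:
  assumes "finite A" "u \<in> A" "v \<in> A"
  shows "dist u v \<le> node_diam A"
  unfolding node_diam_def
  using assms subset_bounding_ball[of A] bounded_bounding_ball[of A]
  by (intro diameter_bounded_bound) auto

lemma node_dist_le_dist:
  assumes "finite A" "finite B" "u \<in> A" "v \<in> B"
  shows "node_dist A B \<le> dist u v"
  unfolding node_dist_def
  using assms subset_bounding_ball[of A] subset_bounding_ball[of B]
  by (intro setdist_le_dist) auto

lemma node_diam_singleton: "node_diam {p} = 0"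
proof -
  \<comment> \<open>The bound \<open>r \<le> 0\<close> is minimality of the radius against
    \<open>cball p 0\<close>.\<close>
  from bounding_ball_is_bounding_ball[of "{p}"] obtain c r where
    B: "bounding_ball {p} = cball c r" "0 \<le> r" "r \<le> 0"
    unfolding is_bounding_ball_def by (metis centre_in_cball empty_subsetI finite.emptyI
        finite.insertI insert_not_empty insert_subset order_refl)
  then show ?thesis by (simp add: node_diam_def)
qed

section \<open>Separation bounds and coverage by the pair search\<close>

lemma mreach_dist_sym: "mreach_dist cd u v = mreach_dist cd v u"
  by (simp add: mreach_dist_def dist_commute max.commute)

lemma well_separated_sym: "well_separated cd A B \<longleftrightarrow> well_separated cd B A"
proof -
  have "node_dist A B = node_dist B A" by (simp add: node_dist_def setdist_sym)
  moreover have "{node_dist B A, cd_min cd A, cd_min cd B} = {node_dist B A, cd_min cd B, cd_min cd A}"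
    "{node_diam A, node_diam B, cd_max cd A, cd_max cd B}
      = {node_diam B, node_diam A, cd_max cd B, cd_max cd A}" by auto
  ultimately show ?thesis
    by (simp only: well_separated_def geometrically_separated_def mutually_unreachable_def
        max.commute)
qed

text \<open>In the geometrically separated case the core distance of \<open>u'\<close> is not controlled by the
  separation but by the minimality of \<open>(u', v')\<close>.\<close>

lemma well_separated_mreach_dist_le:
  assumes fin: "finite A" "finite B"
    and ws: "well_separated cd A B"
    and mem: "u \<in> A" "u' \<in> A" "v \<in> B"
    and closest: "mreach_dist cd u' v' \<le> mreach_dist cd u v"
  shows "mreach_dist cd u u' \<le> mreach_dist cd u v"
proof -
  have cd: "cd u \<le> mreach_dist cd u v" "cd v \<le> mreach_dist cd u v" "cd u' \<le> mreach_dist cd u v"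
    and d: "dist u v \<le> mreach_dist cd u v"
    using closest by (auto simp: mreach_dist_def)
  have AB: "node_dist A B \<le> dist u v" by (rule node_dist_le_dist) (use fin mem in auto)
  have diam: "dist u u' \<le> node_diam A" by (rule dist_le_node_diam) (use fin mem in auto)
  have cdmin: "cd_min cd A \<le> cd u" "cd_min cd B \<le> cd v"
    using fin mem by (auto simp: cd_min_def)
  have "dist u u' \<le> mreach_dist cd u v"
    using ws[unfolded well_separated_def]
  proof
    assume "geometrically_separated A B"
    then show ?thesis using AB diam d by (auto simp: geometrically_separated_def)
  next
    assume "mutually_unreachable cd A B"
    then have "node_diam A \<le> Max {node_dist A B, cd_min cd A, cd_min cd B}"
      by (simp add: mutually_unreachable_def)
    \<comment> \<open>Each entry of the maximum is a lower bound for one of \<open>dist u v\<close>,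
      \<open>cd u\<close> and \<open>cd v\<close>.\<close>
    also have "\<dots> \<le> mreach_dist cd u v" using AB d cd cdmin by simp
    finally show ?thesis using diam by simp
  qed
  then show ?thesis using cd by (simp add: mreach_dist_def[of cd u u'])
qed

text \<open>Both diameters are then at most 0 and a distance is never negative. This is why
  \<open>find_pair\<close> never reaches the empty default for a leaf.\<close>

lemma well_separated_leaf:
  assumes "node_diam (points (Leaf p)) \<ge> node_diam B"
  shows "well_separated cd (points (Leaf p)) B"
  using assms
  by (simp add: well_separated_def geometrically_separated_def node_diam_singleton node_dist_def
      setdist_pos_le)

text \<open>Splitting a node keeps \<open>u\<close> in one of its children, so some recursive call
  retains both points until a pair is recorded. Two orientations occur because of the swaps. The
  inclusions record that the two members of the pair lie on opposite sides.\<close>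

lemma find_pair_covers:
  assumes "u \<in> points A" "v \<in> points B"
  shows "\<exists>C D. (C, D) \<in> find_pair cd A B \<and> well_separated cd (points C) (points D) \<and>
    (u \<in> points C \<and> v \<in> points D \<and> points C \<subseteq> points A \<and> points D \<subseteq> points B \<or>
     v \<in> points C \<and> u \<in> points D \<and> points C \<subseteq> points B \<and> points D \<subseteq> points A)"
  using assms
proof (induction cd A B arbitrary: u v rule: find_pair.induct)
  case (1 cd A B)
  consider "node_diam (points A) < node_diam (points B)"
    | "\<not> node_diam (points A) < node_diam (points B)" "well_separated cd (points A) (points B)"
    | "\<not> node_diam (points A) < node_diam (points B)" "\<not> well_separated cd (points A) (points B)"
    by blast
  then show ?case
  proof cases
    case 1
    then have "find_pair cd A B = find_pair cd B A" by (subst find_pair.simps) simp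
    with "1.IH"(1)[OF 1 "1.prems"(2,1)] show ?thesis by auto
  next
    case 2
    then have "find_pair cd A B = {(A, B)}" by (subst find_pair.simps) simp
    with 2 "1.prems" show ?thesis by auto
  next
    case 3
    \<comment> \<open>A leaf whose diameter is not the smaller one is well-separated from
      \<open>B\<close>, so \<open>A\<close> is internal.\<close>
    then obtain L R where A: "A = Branch L R"
      using well_separated_leaf by (cases A) (auto simp: not_less)
    with 3 have fp: "find_pair cd A B = find_pair cd L B \<union> find_pair cd R B"
      by (subst find_pair.simps) simp
    from "1.prems" A consider "u \<in> points L" | "u \<in> points R" by auto
    then show ?thesis
    proof cases
      case 1
      from "1.IH"(2)[OF 3 A this "1.prems"(2)] obtain C D where
        "(C, D) \<in> find_pair cd L B" "well_separated cd (points C) (points D)"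
        "u \<in> points C \<and> v \<in> points D \<and> points C \<subseteq> points L \<and> points D \<subseteq> points B \<or>
         v \<in> points C \<and> u \<in> points D \<and> points C \<subseteq> points B \<and> points D \<subseteq> points L"
        by blast
      then show ?thesis using A fp by (intro exI[of _ C] exI[of _ D]) auto
    next
      case 2
      from "1.IH"(3)[OF 3 A this "1.prems"(2)] obtain C D where
        "(C, D) \<in> find_pair cd R B" "well_separated cd (points C) (points D)"
        "u \<in> points C \<and> v \<in> points D \<and> points C \<subseteq> points R \<and> points D \<subseteq> points B \<or>
         v \<in> points C \<and> u \<in> points D \<and> points C \<subseteq> points B \<and> points D \<subseteq> points R"
        by blast
      then show ?thesis using A fp by (intro exI[of _ C] exI[of _ D]) auto
    qed
  qed
qed

lemma find_pair_points:
  assumes "(C, D) \<in> find_pair cd A B"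
  shows "points C \<union> points D \<subseteq> points A \<union> points B"
  using assms
proof (induction cd A B rule: find_pair.induct)
  case (1 cd A B)
  show ?case
  proof (cases "node_diam (points A) < node_diam (points B)")
    case True
    then have "find_pair cd A B = find_pair cd B A" by (subst find_pair.simps) simp
    with "1.IH"(1)[OF True] "1.prems" show ?thesis by auto
  next
    case diam: False
    show ?thesis
    proof (cases "well_separated cd (points A) (points B)")
      case True
      then have "find_pair cd A B = {(A, B)}" using diam by (subst find_pair.simps) simp
      with "1.prems" show ?thesis by simp
    next
      case False
      then obtain L R where A: "A = Branch L R"
        using diam well_separated_leaf by (cases A) (auto simp: not_less)
      have "find_pair cd A B = find_pair cd L B \<union> find_pair cd R B"
        using diam False A by (subst find_pair.simps) simp
      with "1.IH"(2,3)[OF diam False A] "1.prems" show ?thesis unfolding A by auto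
    qed
  qed
qed

lemma nodes_points: "N \<in> nodes T \<Longrightarrow> points N \<subseteq> points T"
  by (induction T) auto

lemma pair_decomposition_points:
  assumes "(A, B) \<in> pair_decomposition cd T"
  shows "points A \<union> points B \<subseteq> points T"
proof -
  from assms obtain L R where "Branch L R \<in> nodes T" "(A, B) \<in> find_pair cd L R"
    by (auto simp: pair_decomposition_def)
  then show ?thesis using find_pair_points nodes_points by fastforce
qed

section \<open>The bottleneck property of the closest-pair graph\<close>

text \<open>Formulated for every node so that induction on the subtree yields the paths inside the
  two children; in a leaf \<open>u = v\<close> and the empty path works.\<close>

lemma closest_pair_graph_bottleneck:
  fixes cd :: "'a::euclidean_space \<Rightarrow> real"
  assumes closest: "\<And>A B. (A, B) \<in> pair_decomposition cd T \<Longrightarrow>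
      is_closest_pair (mreach_dist cd) (points A) (points B) (ustar (A, B)) (vstar (A, B))"
    and E: "E = {{ustar s, vstar s} | s. s \<in> pair_decomposition cd T}"
    and "N \<in> nodes T" "u \<in> points N" "v \<in> points N"
  shows "(u, v) \<in> reach (edges_upto (mreach_dist cd) (mreach_dist cd u v) E)"
  using assms(3-)
proof (induction N arbitrary: u v)
  case (Leaf p)
  then show ?case by simp
next
  case (Branch L R)
  let ?w = "mreach_dist cd"
  have N: "L \<in> nodes T" "R \<in> nodes T"
    using Branch.prems(1) nodes_trans[of "Branch L R" T] by auto
  have cross: "(u, v) \<in> reach (edges_upto ?w (?w u v) E)"
    if uv: "u \<in> points L" "v \<in> points R" for u v
  proof -
    have within: "(p, q) \<in> reach (edges_upto ?w (?w u v) E)"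
      if pq: "p \<in> points L \<and> q \<in> points L \<or> p \<in> points R \<and> q \<in> points R"
        and le: "?w p q \<le> ?w u v" for p q
    proof -
      have "(p, q) \<in> reach (edges_upto ?w (?w p q) E)"
        using pq Branch.IH(1)[OF N(1), of p q] Branch.IH(2)[OF N(2), of p q] by argo
      then show ?thesis by (rule reach_mono) (use le in auto)
    qed
    \<comment> \<open>With fresh \<open>u'\<close> and \<open>v'\<close> of the same mutual
      reachability distance, both orientations of the recorded pair are handled at once.\<close>
    have via_pair: "(u', v') \<in> reach (edges_upto ?w (?w u v) E)"
      if CD: "(C, D) \<in> find_pair cd L R" "well_separated cd (points C) (points D)"
        and mem: "u' \<in> points C" "v' \<in> points D"
        and sides: "points C \<subseteq> points L \<and> points D \<subseteq> points R
          \<or> points C \<subseteq> points R \<and> points D \<subseteq> points L"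
        and w: "?w u' v' = ?w u v" for C D u' v'
    proof -
      define a b where "a = ustar (C, D)" and "b = vstar (C, D)"
      have S: "(C, D) \<in> pair_decomposition cd T"
        using CD(1) Branch.prems(1) by (auto simp: pair_decomposition_def)
      then have ab: "a \<in> points C" "b \<in> points D" "?w a b \<le> ?w u' v'"
        using closest[OF S] mem by (auto simp: is_closest_pair_def a_def b_def)
      have "?w u' a \<le> ?w u v"
        using well_separated_mreach_dist_le[of "points C" "points D" cd u' a v' b] CD ab mem w
        by simp
      moreover have "?w v' b \<le> ?w u v"
        using well_separated_mreach_dist_le[of "points D" "points C" cd v' b u' a] CD ab mem w
        by (simp add: well_separated_sym[of cd "points D"] mreach_dist_sym[of cd b]
            mreach_dist_sym[of cd v' u'])
      \<comment> \<open>Each end of the pair shares a child with its representative, so the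
        induction hypotheses apply through \<open>within\<close>.\<close>
      moreover have "u' \<in> points L \<and> a \<in> points L \<or> u' \<in> points R \<and> a \<in> points R"
        "v' \<in> points L \<and> b \<in> points L \<or> v' \<in> points R \<and> b \<in> points R"
        using mem ab(1,2) sides by blast+
      ultimately have u'a: "(u', a) \<in> reach (edges_upto ?w (?w u v) E)"
        and v'b: "(v', b) \<in> reach (edges_upto ?w (?w u v) E)"
        by (auto intro: within)
      have "{a, b} \<in> E" using S by (auto simp: E a_def b_def)
      then have "{a, b} \<in> edges_upto ?w (?w u v) E"
        using ab(3) w by (simp add: edge_weight_doubleton[OF mreach_dist_sym])
      \<comment> \<open>The path runs from \<open>u'\<close> to \<open>a\<close>, across the
        closest-pair edge to \<open>b\<close>, and on to \<open>v'\<close>.\<close>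
      from reach_trans[OF u'a reach_trans[OF reach_edge[OF this] reach_sym[OF v'b]]]
      show ?thesis .
    qed
    from find_pair_covers[OF uv, of cd] obtain C D where
      CD: "(C, D) \<in> find_pair cd L R" "well_separated cd (points C) (points D)" and
      "u \<in> points C \<and> v \<in> points D \<and> points C \<subseteq> points L \<and> points D \<subseteq> points R \<or>
       v \<in> points C \<and> u \<in> points D \<and> points C \<subseteq> points R \<and> points D \<subseteq> points L"
      by blast
    then consider "u \<in> points C" "v \<in> points D" "points C \<subseteq> points L" "points D \<subseteq> points R"
      | "v \<in> points C" "u \<in> points D" "points C \<subseteq> points R" "points D \<subseteq> points L"
      by blast
    then show ?thesis
    proof cases
      case 1
      then show ?thesis by (intro via_pair[OF CD]) auto
    next
      case 2
      then have "(v, u) \<in> reach (edges_upto ?w (?w u v) E)"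
        by (intro via_pair[OF CD]) (auto simp: mreach_dist_sym)
      then show ?thesis by (rule reach_sym)
    qed
  qed
  consider "u \<in> points L" "v \<in> points L" | "u \<in> points R" "v \<in> points R"
    | "u \<in> points L" "v \<in> points R" | "v \<in> points L" "u \<in> points R"
    using Branch.prems by auto
  then show ?case
  proof cases
    case 1
    then show ?thesis by (rule Branch.IH(1)[OF N(1)])
  next
    case 2
    then show ?thesis by (rule Branch.IH(2)[OF N(2)])
  next
    case 3
    then show ?thesis by (rule cross)
  next
    case 4
    from reach_sym[OF cross[OF this]] show ?thesis by (simp add: mreach_dist_sym[of cd v u])
  qed
qed

theorem theorem3p2:
  fixes P :: "(real ^ 'd) set"
    and minPts :: nat
    and T :: "(real ^ 'd) ptree"
    and cd :: "real ^ 'd \<Rightarrow> real"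
    and d_m :: "real ^ 'd \<Rightarrow> real ^ 'd \<Rightarrow> real"
    and S :: "((real ^ 'd) ptree \<times> (real ^ 'd) ptree) set"
    and ustar vstar :: "(real ^ 'd) ptree \<times> (real ^ 'd) ptree \<Rightarrow> real ^ 'd"
    and E' F :: "(real ^ 'd) set set"
  assumes "finite P"
    and "minPts \<ge> 1"
    and "is_tree_on T P"
    and "cd = core_dist P minPts"
    and "d_m = mreach_dist cd"
    and "S = pair_decomposition cd T"
    and "\<And>A B. (A, B) \<in> S \<Longrightarrow>
           is_closest_pair d_m (points A) (points B) (ustar (A, B)) (vstar (A, B))"
    and "E' = {{ustar s, vstar s} | s. s \<in> S}"
    and "is_mst P E' d_m F"
  shows "is_mst P (complete_edges P) d_m F"
proof -
  have T: "points T = P" using assms(3) by (simp add: is_tree_on_def)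
  have closest: "is_closest_pair (mreach_dist cd) (points A) (points B) (ustar (A, B)) (vstar (A, B))"
    if "(A, B) \<in> pair_decomposition cd T" for A B
    using assms(5-7) that by simp
  have E': "E' = {{ustar s, vstar s} | s. s \<in> pair_decomposition cd T}"
    using assms(6,8) by simp
  have gr: "is_graph P F" using assms(9) by (simp add: is_mst_def is_spanning_tree_def)
  show ?thesis
  proof (rule mst_of_bottleneck_subgraph[OF assms(1,9)])
    show "F \<subseteq> complete_edges P"
    proof
      fix e assume "e \<in> F"
      \<comment> \<open>A spanning tree is a graph by definition, so each of its edges has two
        distinct ends in \<open>P\<close>.\<close>
      with gr obtain x y where "e = {x, y}" "x \<noteq> y" "x \<in> P" "y \<in> P" by (rule graph_edge_cases)
      then show "e \<in> complete_edges P" by (auto simp: complete_edges_def)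
    qed
  next
    fix a b assume "a \<in> P" "b \<in> P"
    \<comment> \<open>The bottleneck property at the root, whose point set is
      \<open>P\<close>.\<close>
    then have "(a, b) \<in> reach (edges_upto (mreach_dist cd) (mreach_dist cd a b) E')"
      using closest_pair_graph_bottleneck[OF closest E' node_in_nodes] T by simp
    then show "(a, b) \<in> reach (edges_upto d_m (edge_weight d_m {a, b}) E')"
      by (simp add: assms(5) edge_weight_doubleton[OF mreach_dist_sym])
  next
    fix e assume "e \<in> E'"
    then obtain A B where AB: "(A, B) \<in> pair_decomposition cd T"
      "e = {ustar (A, B), vstar (A, B)}" using E' by auto
    then show "e \<subseteq> P"
      using closest[OF AB(1)] pair_decomposition_points[OF AB(1)] T
      by (auto simp: is_closest_pair_def)
  qed
qed

end
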